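(* Let $n\ge 1$ be an integer, $a\in\mathbb{C}$ with $\operatorname{Re}a>0$, and let $\beta$ be real with $0<\beta\le 2\operatorname{Re}a$. Let $p\in\mathcal{H}_\beta[a,n]$. (i) Let $\Omega\subset\mathbb{C}$ be a domain and let $\psi\in\Psi_{n,\beta}(\Omega,a)$ with associated domain $D$. If $(p(z),zp'(z),z^2p''(z))\in D$ and $$\psi(p(z),zp'(z),z^2p''(z))\in\Omega\qquad\text{for all }z\in\mathbb{D},$$ then $\operatorname{Re}p(z)>0$ for all $z\in\mathbb{D}$. (ii) Let $\psi\in\Psi_{n,\beta}(a)$ with associated domain $D$. If $(p(z),zp'(z),z^2p''(z))\in D$ and $$\operatorname{Re}\psi(p(z),zp'(z),z^2p''(z))>0\qquad\text{for all }z\in\mathbb{D},$$ then $\operatorname{Re}p(z)>0$ for all $z\in\mathbb{D}$.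
   Context: $\mathbb{D}=\{z\in\mathbb{C}:|z|<1\}$. For $a\in\mathbb{C}$, a positive integer $n$ and a fixed real $\beta\ge 0$, $\mathcal{H}_\beta[a,n]$ is the class of analytic functions $p$ in $\mathbb{D}$ of the form $p(z)=a+\beta z^n+p_{n+1}z^{n+1}+\cdots$. For a domain $\Omega\subset\mathbb{C}$, the class $\Psi_{n,\beta}(\Omega,a)$ consists of those functions $\psi:\mathbb{C}^3\to\mathbb{C}$ that are continuous in a domain $D\subset\mathbb{C}^3$ (the associated domain) with $(a,0,0)\in D$ and $\psi(a,0,0)\in\Omega$, and that satisfy $\psi(i\rho,\sigma,\mu+i\nu)\notin\Omega$ whenever $(i\rho,\sigma,\mu+i\nu)\in D$, $$\sigma\le-\frac12\left(n+\frac{2\operatorname{Re}a-\beta}{2\operatorname{Re}a+\beta}\right)\frac{|a-i\rho|^2}{\operatorname{Re}a}\qquad\text{and}\qquad \sigma+\mu\le 0,$$ where $\rho,\sigma,\mu,\nu\in\mathbb{R}$. $\Psi_{n,\beta}(a)$ denotes the class $\Psi_{n,\beta}(\Omega,a)$ with $\Omega=\{w\in\mathbb{C}:\operatorname{Re}w>0\}$. *)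

theory Defs
  imports "HOL-Analysis.Analysis"
begin

definition is_domain :: "'a::topological_space set \<Rightarrow> bool" where
  "is_domain S \<longleftrightarrow> S \<noteq> {} \<and> open S \<and> connected S"

text \<open>The tail coefficients are indexed so that \<open>c k\<close> is the coefficient of \<open>z ^ (n + 1 + k)\<close>.\<close>

definition H_class :: "real \<Rightarrow> complex \<Rightarrow> nat \<Rightarrow> (complex \<Rightarrow> complex) set" where
  "H_class \<beta> a n = {p. p analytic_on ball 0 1 \<and>
     (\<exists>c :: nat \<Rightarrow> complex. \<forall>z\<in>ball 0 1.
        (\<lambda>k. c k * z ^ (n + 1 + k)) sums (p z - (a + complex_of_real \<beta> * z ^ n)))}"

text \<open>
  Three-dimensional complex space is rendered as a nested product (same topology).
  The associated domain \<open>D\<close> is a parameter: the class of all admissible \<open>\<psi>\<close> for \<open>\<Omega>\<close>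
  is the union of \<open>Psi_class n \<beta> \<Omega> a D\<close> over all \<open>D\<close>. Nothing is required of \<open>\<psi>\<close> outside \<open>D\<close>.
\<close>

definition Psi_class ::
  "nat \<Rightarrow> real \<Rightarrow> complex set \<Rightarrow> complex \<Rightarrow> (complex \<times> complex \<times> complex) set
     \<Rightarrow> (complex \<times> complex \<times> complex \<Rightarrow> complex) set" where
  "Psi_class n \<beta> \<Omega> a D = {\<psi>.
     is_domain D \<and> continuous_on D \<psi> \<and>
     (a, 0, 0) \<in> D \<and> \<psi> (a, 0, 0) \<in> \<Omega> \<and>
     (\<forall>\<rho> \<sigma> \<mu> \<nu> :: real.
        (\<i> * complex_of_real \<rho>, complex_of_real \<sigma>,
          complex_of_real \<mu> + \<i> * complex_of_real \<nu>) \<in> D \<longrightarrow>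
        \<sigma> \<le> - (1 / 2) * (real n + (2 * Re a - \<beta>) / (2 * Re a + \<beta>))
               * ((cmod (a - \<i> * complex_of_real \<rho>))\<^sup>2 / Re a) \<longrightarrow>
        \<sigma> + \<mu> \<le> 0 \<longrightarrow>
        \<psi> (\<i> * complex_of_real \<rho>, complex_of_real \<sigma>,
          complex_of_real \<mu> + \<i> * complex_of_real \<nu>) \<notin> \<Omega>)}"

definition Psi_class_rhp ::
  "nat \<Rightarrow> real \<Rightarrow> complex \<Rightarrow> (complex \<times> complex \<times> complex) set
     \<Rightarrow> (complex \<times> complex \<times> complex \<Rightarrow> complex) set" where
  "Psi_class_rhp n \<beta> a D = Psi_class n \<beta> {w. Re w > 0} a D"

end

theory Submission
  imports Defs "HOL-Complex_Analysis.Complex_Analysis"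
begin

text \<open>
  If \<open>Re p\<close> is not positive throughout the disc, take a zero \<open>z\<^sub>0\<close> of \<open>Re p\<close> of least modulus
  and put \<open>q z = p (z\<^sub>0 z)\<close>, so that \<open>Re q > 0\<close> in the disc and \<open>q 1\<close> is purely imaginary.
  Since \<open>\<theta> \<mapsto> Re (q (e\<^sup>i\<^sup>\<theta>))\<close> is minimal at \<open>0\<close>, its first two derivatives show
  that \<open>q' 1\<close> is real and \<open>Re (q' 1 + q'' 1) \<le> 0\<close>. The Cayley transform
  \<open>(a - q) / (cnj a + q)\<close> equals \<open>z ^ n\<close> times a function bounded by \<open>1\<close>, to which the
  Schwarz-Pick inequality applies; comparing derivatives along the radius to \<open>1\<close> bounds
  \<open>q' 1\<close> from above. So the triple at \<open>z\<^sub>0\<close> is one that admissibility sends outside \<open>\<Omega>\<close>.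
\<close>

section \<open>Bounds of Schwarz and Schwarz-Pick type on the unit disc\<close>

text \<open>On the circle of radius \<open>r\<close> the hypothesis gives the bound
  \<open>1 / r ^ n\<close>. The maximum modulus principle carries it to the interior, and
  \<open>r\<close> tends to 1 from below.\<close>

lemma norm_le_one_if_power_mult_le_one:
  fixes f :: "complex \<Rightarrow> complex"
  assumes hol: "f holomorphic_on ball 0 1"
    and le: "\<And>z. z \<in> ball 0 1 \<Longrightarrow> cmod (z ^ n * f z) \<le> 1"
    and z: "z \<in> ball 0 1"
  shows "cmod (f z) \<le> 1"
proof -
  have bound: "cmod (f z) \<le> 1 / r ^ n" if r: "cmod z < r" "r < 1" for r
  proof (rule maximum_modulus_frontier [of f "cball 0 r"])
    have sub: "cball 0 r \<subseteq> ball (0::complex) 1"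
      using r by auto
    show "f holomorphic_on interior (cball 0 r)"
      using hol sub interior_subset holomorphic_on_subset by (metis subset_trans)
    show "continuous_on (closure (cball 0 r)) f"
      using hol sub by (auto intro: holomorphic_on_imp_continuous_on holomorphic_on_subset)
    show "cmod (f w) \<le> 1 / r ^ n" if "w \<in> frontier (cball 0 r)" for w
    proof -
      have "cmod w = r" "r > 0"
        using that r by (auto simp: dist_norm order.strict_trans1 [OF norm_ge_zero])
      then show ?thesis
        using le [of w] r by (simp add: norm_mult norm_power field_simps)
    qed
  qed (use r in auto)
  have "((\<lambda>r. 1 / r ^ n) \<longlongrightarrow> 1 / 1 ^ n) (at_left (1::real))"
    by (intro tendsto_intros) auto
  moreover have "\<forall>\<^sub>F r in at_left 1. cmod (f z) \<le> 1 / r ^ n"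
    using bound z by (auto simp: eventually_at_left [of "0::real" 1] intro!: exI [of _ "cmod z"])
  ultimately have "cmod (f z) \<le> 1 / 1 ^ n"
    by (intro tendsto_lowerbound [where F = "at_left (1::real)"]) auto
  then show ?thesis
    by simp
qed

text \<open>Composing \<open>f\<close> with the disc automorphism that sends \<open>f 0\<close> to 0
  gives a map \<open>g\<close> to which the Schwarz lemma applies. Squaring
  \<open>|g z| \<le> |z|\<close> and expanding isolates \<open>|f z|\<close>.\<close>

lemma Schwarz_Pick_origin:
  fixes f :: "complex \<Rightarrow> complex"
  assumes hol: "f holomorphic_on ball 0 1"
    and le: "\<And>z. z \<in> ball 0 1 \<Longrightarrow> cmod (f z) \<le> 1"
    and f0: "cmod (f 0) < 1"
    and z: "z \<in> ball 0 1"
  shows "cmod (f z) \<le> (cmod z + cmod (f 0)) / (1 + cmod (f 0) * cmod z)"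
proof -
  \<comment> \<open>Strictness keeps the denominator of \<open>g\<close> away from 0 and the values
    of \<open>g\<close> in the open disc. If the modulus 1 were attained, \<open>f\<close> would be
    constant, against \<open>f0\<close>.\<close>
  have lt: "cmod (f w) < 1" if w: "w \<in> ball 0 1" for w
  proof (rule ccontr)
    assume "\<not> cmod (f w) < 1"
    then have "cmod (f w) = 1"
      using le [OF w] by simp
    then have "f constant_on ball 0 1"
      by (intro maximum_modulus_principle [OF hol, of "ball 0 1" w]) (use le w in auto)
    then have "f w = f 0"
      using w by (auto simp: constant_on_def)
    then show False
      using f0 \<open>cmod (f w) = 1\<close> by simp
  qed
  define c where "c = f 0"
  define g where "g = (\<lambda>w. (f w - c) / (1 - cnj c * f w))"
  have c: "cmod c < 1"
    using f0 by (simp add: c_def)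
  have ident: "(cmod (1 - cnj c * w))\<^sup>2 - (cmod (w - c))\<^sup>2 = (1 - (cmod c)\<^sup>2) * (1 - (cmod w)\<^sup>2)" for w
    unfolding cmod_power2 by (simp add: algebra_simps power2_eq_square)
  have pos: "(1 - (cmod c)\<^sup>2) * (1 - (cmod (f w))\<^sup>2) > 0" if "w \<in> ball 0 1" for w
    using c lt [OF that] by (simp add: power_less_one_iff abs_square_less_1)
  have less: "cmod (f w - c) < cmod (1 - cnj c * f w)" if "w \<in> ball 0 1" for w
    using ident [of "f w"] pos [OF that] by (simp add: power2_less_imp_less)
  have "cmod (g z) \<le> cmod z"
  proof (rule Schwarz_Lemma)
    show "g holomorphic_on ball 0 1"
      unfolding g_def using less by (intro holomorphic_intros hol) fastforce
    show "cmod (g w) < 1" if "cmod w < 1" for w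
      using less [of w] that by (auto simp: g_def norm_divide divide_less_eq_1)
  qed (use z in \<open>auto simp: g_def c_def\<close>)
  then have "cmod (f z - c) \<le> cmod z * cmod (1 - cnj c * f z)"
    using less [OF z] le_less_trans [OF norm_ge_zero less [OF z]]
    by (simp add: g_def norm_divide divide_le_eq)
  then have sq: "(cmod (f z - c))\<^sup>2 \<le> (cmod z)\<^sup>2 * (cmod (1 - cnj c * f z))\<^sup>2"
    by (metis norm_ge_zero power_mono power_mult_distrib)
  define R where "R = Re (cnj c * f z)"
  have num: "(cmod (f z - c))\<^sup>2 = (cmod (f z))\<^sup>2 + (cmod c)\<^sup>2 - 2 * R"
    unfolding R_def cmod_power2 by (simp add: algebra_simps power2_eq_square)
  have den: "(cmod (1 - cnj c * f z))\<^sup>2 = 1 + (cmod c)\<^sup>2 * (cmod (f z))\<^sup>2 - 2 * R"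
    unfolding R_def cmod_power2 by (simp add: algebra_simps power2_eq_square)
  have "R \<le> cmod c * cmod (f z)"
    unfolding R_def by (metis complex_Re_le_cmod complex_mod_cnj norm_mult)
  \<comment> \<open>In \<open>sq\<close> the terms with \<open>R\<close> combine to a multiple of
    \<open>(1 - |z|^2) * R\<close>. Replacing \<open>R\<close> by its upper bound
    \<open>|c| |f z|\<close> leaves a perfect square on each side.\<close>
  then have "(1 - (cmod z)\<^sup>2) * R \<le> (1 - (cmod z)\<^sup>2) * (cmod c * cmod (f z))"
    using z by (intro mult_left_mono) (auto simp: abs_square_le_1)
  with sq have sq': "(cmod (f z) - cmod c)\<^sup>2 \<le> (cmod z * (1 - cmod c * cmod (f z)))\<^sup>2"
    unfolding num den by (simp add: power2_eq_square algebra_simps)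
  have "cmod c * cmod (f z) \<le> 1"
    using c le [OF z] by (simp add: mult_le_one)
  then have "cmod (f z) - cmod c \<le> cmod z * (1 - cmod c * cmod (f z))"
    by (intro power2_le_imp_le [OF sq'] mult_nonneg_nonneg) auto
  moreover have "1 + cmod c * cmod z > 0"
    by (intro add_pos_nonneg) auto
  ultimately show ?thesis
    by (simp add: c_def [symmetric] field_simps)
qed

section \<open>The Cayley transform and the radial derivative at a boundary point\<close>

text \<open>The factor \<open>H\<close> left after removing \<open>z ^ n\<close> from the Cayley
  transform of \<open>q\<close> is bounded by 1 and has modulus \<open>x\<close> at 0, so the
  Schwarz-Pick bound controls it. Clearing the denominator gives an inequality that can be squared
  and differentiated.\<close>

lemma norm_Cayley_le:
  assumes a: "Re a > 0"
    and hol: "h holomorphic_on ball 0 1"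
    and q: "\<And>z. z \<in> ball 0 1 \<Longrightarrow> q z = a + z ^ n * h z"
    and Re_q: "\<And>z. z \<in> ball 0 1 \<Longrightarrow> Re (q z) > 0"
    and x: "x = cmod (h 0) / (2 * Re a)" "x < 1"
    and n: "n \<ge> 1" and z: "z \<in> ball 0 1"
  shows "cmod (a - q z) \<le> cmod z ^ n * ((cmod z + x) / (1 + x * cmod z)) * cmod (cnj a + q z)"
proof -
  define H where "H = (\<lambda>z. - h z / (cnj a + (a + z ^ n * h z)))"
  have nz: "cnj a + (a + w ^ n * h w) \<noteq> 0" if "w \<in> ball 0 1" for w
  proof -
    have "Re (cnj a + (a + w ^ n * h w)) > 0"
      using q [OF that] Re_q [OF that] a by simp
    then show ?thesis
      by force
  qed
  have H: "w ^ n * H w = (a - q w) / (cnj a + q w)" if "w \<in> ball 0 1" for w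
    using q [OF that] by (simp add: H_def)
  have "H holomorphic_on ball 0 1"
    unfolding H_def using nz by (intro holomorphic_intros hol) auto
  moreover have "cmod (H w) \<le> 1" if "w \<in> ball 0 1" for w
  proof (rule norm_le_one_if_power_mult_le_one [OF \<open>H holomorphic_on ball 0 1\<close> _ that])
    fix w :: complex assume w: "w \<in> ball 0 1"
    have "(cmod (cnj a + q w))\<^sup>2 - (cmod (a - q w))\<^sup>2 = 4 * Re a * Re (q w)"
      unfolding cmod_power2 by (simp add: algebra_simps power2_eq_square)
    also have "\<dots> > 0"
      using a Re_q [OF w] by simp
    finally have "cmod (a - q w) \<le> cmod (cnj a + q w)"
      by (simp add: power2_le_imp_le)
    then show "cmod (w ^ n * H w) \<le> 1"
      by (simp add: H [OF w] norm_divide divide_le_eq_1)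
  qed
  \<comment> \<open>As \<open>n \<ge> 1\<close>, the power vanishes at 0, where the denominator of
    \<open>H\<close> is therefore \<open>2 * Re a\<close>.\<close>
  moreover have "cmod (H 0) = x"
  proof -
    have "cnj a + a = of_real (2 * Re a)"
      by (simp add: complex_eq_iff)
    then show ?thesis
      using a n x by (simp add: H_def norm_divide power_0_left del: of_real_mult)
  qed
  ultimately have "cmod (H z) \<le> (cmod z + x) / (1 + x * cmod z)"
    using Schwarz_Pick_origin [of H z] x z by simp
  then have "cmod (z ^ n * H z) \<le> cmod z ^ n * ((cmod z + x) / (1 + x * cmod z))"
    unfolding norm_mult norm_power by (intro mult_left_mono) auto
  then show ?thesis
    using nz [OF z] q [OF z] unfolding H [OF z] norm_divide
    by (subst (asm) pos_divide_le_eq) auto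
qed

text \<open>The squared hypothesis says \<open>F \<ge> 0\<close> on (0,1), while
  \<open>F 1 = 0\<close>; hence the derivative of \<open>F\<close> at 1 is at most 0. The constant
  in the bound is the derivative of \<open>B\<close> at 1.\<close>

lemma boundary_deriv_bound:
  fixes q :: "complex \<Rightarrow> complex"
  assumes a: "Re a > 0"
    and der: "(q has_field_derivative q') (at 1)"
    and q1: "Re (q 1) = 0"
    and x: "0 \<le> x"
    and le: "\<And>t. 0 < t \<Longrightarrow> t < 1 \<Longrightarrow> cmod (a - q (of_real t))
      \<le> t ^ n * ((t + x) / (1 + x * t)) * cmod (cnj a + q (of_real t))"
  shows "Re q' \<le> - (1 / 2) * (real n + (1 - x) / (1 + x)) * ((cmod (a - q 1))\<^sup>2 / Re a)"
proof -
  define N where "N = (\<lambda>t::real. (Re (q (of_real t)) + Re a)\<^sup>2 + (Im (q (of_real t)) - Im a)\<^sup>2)"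
  define B where "B = (\<lambda>t::real. t ^ n * ((t + x) / (1 + x * t)))"
  \<comment> \<open>By the identity \<open>|cnj a + q|^2 - |a - q|^2 = 4 * Re a * Re q\<close>, this
    is \<open>B^2 * |cnj a + q|^2 - |a - q|^2\<close>, written so that it is visibly
    differentiable.\<close>
  define F where "F = (\<lambda>t::real. 4 * Re a * Re (q (of_real t)) - (1 - (B t)\<^sup>2) * N t)"
  have "((\<lambda>t::real. q (of_real t)) has_vector_derivative q') (at 1)"
    using has_vector_derivative_real_field [of q q' 1] der by simp
  then have u: "((\<lambda>t::real. Re (q (of_real t))) has_real_derivative Re q') (at 1)"
    and v: "((\<lambda>t::real. Im (q (of_real t))) has_real_derivative Im q') (at 1)"
    by (auto simp: has_vector_derivative_complex_iff)
  \<comment> \<open>The value of \<open>N'\<close> does not matter: in the derivative of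
    \<open>F\<close> at 1 it is multiplied by \<open>1 - (B 1)^2 = 0\<close>.\<close>
  obtain N' where N': "(N has_real_derivative N') (at 1)"
    using DERIV_add [OF DERIV_power [OF DERIV_add [OF u DERIV_const [of "Re a"]], of 2]
        DERIV_power [OF DERIV_diff [OF v DERIV_const [of "Im a"]], of 2]]
    unfolding N_def by blast
  have B1: "B 1 = 1"
    using x by (simp add: B_def)
  have B': "(B has_real_derivative (real n + (1 - x) / (1 + x))) (at 1)"
    unfolding B_def using x
    by (auto intro!: derivative_eq_intros simp: divide_simps) (simp add: algebra_simps)
  have F': "(F has_real_derivative
      4 * Re a * Re q' + 2 * (real n + (1 - x) / (1 + x)) * N 1) (at 1)"
    unfolding F_def
    by (rule DERIV_diff [OF DERIV_cmult [OF u]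
          DERIV_mult [OF DERIV_diff [OF DERIV_const DERIV_power [OF B']] N'], THEN DERIV_cong])
       (simp add: B1 algebra_simps)
  have F1: "F 1 = 0"
    by (simp add: F_def B1 q1)
  have N_eq: "N t = (cmod (cnj a + q (of_real t)))\<^sup>2" for t
    by (simp add: N_def cmod_power2 algebra_simps)
  have F_ge: "F t \<ge> 0" if t: "0 < t" "t < 1" for t
  proof -
    have "(cmod (a - q (of_real t)))\<^sup>2 \<le> (B t * cmod (cnj a + q (of_real t)))\<^sup>2"
      using le [OF t] by (intro power_mono) (auto simp: B_def)
    moreover have "N t - (cmod (a - q (of_real t)))\<^sup>2 = 4 * Re a * Re (q (of_real t))"
      unfolding N_eq cmod_power2 by (simp add: algebra_simps power2_eq_square)
    ultimately show ?thesis
      by (simp add: F_def N_eq power_mult_distrib algebra_simps)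
  qed
  have "4 * Re a * Re q' + 2 * (real n + (1 - x) / (1 + x)) * N 1 \<le> 0"
  proof (rule ccontr)
    assume "\<not> ?thesis"
    then obtain d where "d > 0" and d: "\<And>h. 0 < h \<Longrightarrow> h < d \<Longrightarrow> F (1 - h) < F 1"
      using DERIV_pos_inc_left [OF F'] by (auto simp: not_le)
    define h where "h = min (d / 2) (1 / 2)"
    have "0 < h" "h < d" "h < 1"
      using \<open>d > 0\<close> by (auto simp: h_def)
    then show False
      using d [of h] F_ge [of "1 - h"] F1 by simp
  qed
  moreover have "N 1 = (cmod (a - q 1))\<^sup>2"
    using q1 unfolding N_eq cmod_power2 by (simp add: power2_eq_square algebra_simps)
  moreover define K where "K = real n + (1 - x) / (1 + x)"
  ultimately show ?thesis
    using a unfolding K_def [symmetric] by (simp add: field_simps)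
qed

section \<open>Angular derivatives at a boundary minimum\<close>

text \<open>If \<open>l < 0\<close>, then \<open>f'\<close> would be negative just to the right of
  its zero \<open>x\<close>, so \<open>f\<close> would fall below its minimum there.
  Differentiability of \<open>f'\<close> at the single point \<open>x\<close> suffices.\<close>

lemma second_derivative_at_local_min:
  fixes f :: "real \<Rightarrow> real"
  assumes der: "\<And>t. \<bar>t - x\<bar> < e \<Longrightarrow> (f has_real_derivative f' t) (at t)"
    and der2: "(f' has_real_derivative l) (at x)"
    and e: "e > 0"
    and min: "\<And>t. \<bar>t - x\<bar> < e \<Longrightarrow> f x \<le> f t"
  shows "f' x = 0" and "l \<ge> 0"
proof -
  show 0: "f' x = 0"
    using DERIV_local_min [of f "f' x" x e] der [of x] e min by (simp add: abs_minus_commute)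
  show "l \<ge> 0"
  proof (rule ccontr)
    assume "\<not> l \<ge> 0"
    then obtain d where "d > 0" and d: "\<And>h. 0 < h \<Longrightarrow> h < d \<Longrightarrow> f' (x + h) < f' x"
      using DERIV_neg_dec_right [OF der2] by auto
    define y where "y = x + min (d / 2) (e / 2)"
    have y: "x < y" "y < x + d" "y < x + e"
      using \<open>d > 0\<close> e by (auto simp: y_def)
    have "f y < f x"
    proof (rule DERIV_neg_imp_decreasing_open [OF y(1)])
      show "\<exists>m. (f has_real_derivative m) (at t) \<and> m < 0" if "x < t" "t < y" for t
        using der [of t] d [of "t - x"] that y 0 by (intro exI [of _ "f' t"]) auto
      have "isCont f t" if "t \<in> {x..y}" for t
        using der [of t] that y DERIV_isCont by force
      then show "continuous_on {x..y} f"
        by (simp add: continuous_at_imp_continuous_on)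
    qed
    then show False
      using min [of y] y by simp
  qed
qed

text \<open>Along \<open>q (exp (\<i> * t))\<close> the derivative at \<open>t = 0\<close> is
  \<open>\<i> * deriv q 1\<close>, with real part \<open>- Im (deriv q 1)\<close>, and the second
  derivative is \<open>- (deriv q 1 + deriv (deriv q) 1)\<close>. The real part has a minimum at
  \<open>t = 0\<close>.\<close>

lemma boundary_min_angular_derivs:
  fixes q :: "complex \<Rightarrow> complex"
  assumes hol: "q holomorphic_on ball 0 r" and r: "r > 1"
    and nonneg: "\<And>z. cmod z = 1 \<Longrightarrow> Re (q z) \<ge> 0"
    and q1: "Re (q 1) = 0"
  shows "Im (deriv q 1) = 0" and "Re (deriv q 1 + deriv (deriv q) 1) \<le> 0"
proof -
  have hol': "deriv q holomorphic_on ball 0 r"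
    by (intro holomorphic_deriv hol) auto
  have der: "(q has_field_derivative deriv q (exp (\<i> * of_real t))) (at (exp (\<i> * of_real t)))"
    and der2: "(deriv q has_field_derivative deriv (deriv q) (exp (\<i> * of_real t)))
      (at (exp (\<i> * of_real t)))" for t :: real
    using r by (auto intro!: holomorphic_derivI [OF hol] holomorphic_derivI [OF hol'])
  have E: "((\<lambda>w. exp (\<i> * w)) has_field_derivative \<i> * exp (\<i> * w)) (at w)" for w :: complex
    by (auto intro!: derivative_eq_intros)
  have d1: "((\<lambda>w. q (exp (\<i> * w))) has_field_derivative
      deriv q (exp (\<i> * of_real t)) * (\<i> * exp (\<i> * of_real t))) (at (of_real t))" for t :: real
    by (rule DERIV_chain2 [OF der E])
  have d2: "((\<lambda>w. deriv q (exp (\<i> * w)) * (\<i> * exp (\<i> * w))) has_field_derivative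
      - (deriv q 1 + deriv (deriv q) 1)) (at (of_real 0))"
    using DERIV_mult [OF DERIV_chain2 [OF der2 [of 0] E [of "of_real 0"]] DERIV_cmult [OF E [of "of_real 0"], of \<i>]]
    by (simp add: algebra_simps)
  define f where "f = (\<lambda>t::real. Re (q (exp (\<i> * of_real t))))"
  define f' where "f' = (\<lambda>t::real. Re (deriv q (exp (\<i> * of_real t)) * (\<i> * exp (\<i> * of_real t))))"
  have f: "(f has_real_derivative f' t) (at t)" for t
    using has_vector_derivative_real_field [OF d1 [of t]]
    unfolding f_def f'_def has_vector_derivative_complex_iff by blast
  have f': "(f' has_real_derivative Re (- (deriv q 1 + deriv (deriv q) 1))) (at 0)"
    using has_vector_derivative_real_field [OF d2]
    unfolding f'_def has_vector_derivative_complex_iff by blast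
  have min: "f 0 \<le> f t" for t
    using nonneg [of "exp (\<i> * of_real t)"] q1 by (simp add: f_def)
  show "Im (deriv q 1) = 0"
    using second_derivative_at_local_min(1) [where e = 1, OF f f'] min by (simp add: f'_def)
  show "Re (deriv q 1 + deriv (deriv q) 1) \<le> 0"
    using second_derivative_at_local_min(2) [where e = 1, OF f f'] min by simp
qed

section \<open>The first boundary point and the values of \<open>p\<close> there\<close>

text \<open>Supplies \<open>(p - a) / z ^ n\<close> as a function holomorphic also at 0; it is
  \<open>\<beta> + z * s z\<close>, where \<open>s\<close> sums the tail coefficients.\<close>

lemma H_class_factor:
  assumes "p \<in> H_class \<beta> a n"
  obtains h where "h holomorphic_on ball 0 1" "h 0 = of_real \<beta>"
    "\<And>z. z \<in> ball 0 1 \<Longrightarrow> p z = a + z ^ n * h z"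
proof -
  obtain c where c: "\<And>z. z \<in> ball 0 1 \<Longrightarrow>
      (\<lambda>k. c k * z ^ (n + 1 + k)) sums (p z - (a + complex_of_real \<beta> * z ^ n))"
    using assms unfolding H_class_def by blast
  define s where "s = (\<lambda>z. \<Sum>k. c k * z ^ k)"
  have s: "(\<lambda>k. c k * z ^ k) sums s z" if z: "z \<in> ball 0 1" for z
  proof (cases "z = 0")
    case False
    then have "summable (\<lambda>k. c k * z ^ (n + 1 + k) / z ^ (n + 1))"
      using sums_summable [OF c [OF z]] summable_divide by blast
    then show ?thesis
      using False by (simp add: s_def power_add summable_sums)
  qed (auto simp: s_def)
  have "s holomorphic_on ball 0 1"
    using power_series_holomorphic [of 0 1 c s] s by simp
  then have "(\<lambda>z. of_real \<beta> + z * s z) holomorphic_on ball 0 1"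
    by (intro holomorphic_intros)
  moreover have "p z = a + z ^ n * (of_real \<beta> + z * s z)" if z: "z \<in> ball 0 1" for z
  proof -
    have "(\<lambda>k. c k * z ^ (n + 1 + k)) sums (z ^ (n + 1) * s z)"
      using sums_mult [OF s [OF z], of "z ^ (n + 1)"] by (simp add: power_add mult_ac)
    then have "p z - (a + complex_of_real \<beta> * z ^ n) = z ^ (n + 1) * s z"
      using c [OF z] sums_unique2 by blast
    then show ?thesis
      by (simp add: algebra_simps)
  qed
  ultimately show ?thesis
    by (intro that [of "\<lambda>z. of_real \<beta> + z * s z"]) auto
qed

text \<open>The points of the closed disc of radius \<open>|z\<^sub>1|\<close> with
  \<open>Re p \<le> 0\<close> form a nonempty compact set, on which the modulus attains its
  minimum.\<close>

lemma first_nonpos_Re: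
  fixes p :: "complex \<Rightarrow> complex"
  assumes cont: "continuous_on (ball 0 1) p" and z1: "z\<^sub>1 \<in> ball 0 1" "Re (p z\<^sub>1) \<le> 0"
  obtains z\<^sub>0 where "z\<^sub>0 \<in> ball 0 1" "Re (p z\<^sub>0) \<le> 0" "\<And>z. cmod z < cmod z\<^sub>0 \<Longrightarrow> Re (p z) > 0"
proof -
  define K where "K = {z \<in> cball 0 (cmod z\<^sub>1). Re (p z) \<le> 0}"
  have sub: "cball 0 (cmod z\<^sub>1) \<subseteq> ball (0::complex) 1"
    using z1 by auto
  have "closed (cball 0 (cmod z\<^sub>1) \<inter> p -` {w. Re w \<le> 0})"
    by (intro continuous_closed_preimage continuous_on_subset [OF cont sub] closed_halfspace_Re_le
        closed_cball)
  also have "cball 0 (cmod z\<^sub>1) \<inter> p -` {w. Re w \<le> 0} = K"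
    by (auto simp: K_def)
  finally have "closed K" .
  then have "compact K"
    by (metis (no_types, lifting) K_def bounded_cball bounded_subset compact_eq_bounded_closed
        mem_Collect_eq subsetI)
  moreover have "z\<^sub>1 \<in> K"
    using z1 by (auto simp: K_def)
  ultimately obtain z\<^sub>0 where z0: "z\<^sub>0 \<in> K" "\<And>z. z \<in> K \<Longrightarrow> cmod z\<^sub>0 \<le> cmod z"
    using continuous_attains_inf [of K cmod] continuous_on_norm_id by blast
  show ?thesis
  proof
    show "z\<^sub>0 \<in> ball 0 1" "Re (p z\<^sub>0) \<le> 0"
      using z0 sub by (auto simp: K_def)
    show "Re (p z) > 0" if "cmod z < cmod z\<^sub>0" for z
      using z0(2) [of z] z0(1) that by (force simp: K_def)
  qed
qed

text \<open>Rescaling by \<open>z\<^sub>0\<close> turns the derivatives of \<open>q\<close> at 1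
  into \<open>z\<^sub>0 * deriv p z\<^sub>0\<close> and
  \<open>z\<^sub>0\<^sup>2 * deriv (deriv p) z\<^sub>0\<close>, so the radial and angular estimates
  at 1 become statements about the triple in the admissibility condition.\<close>

lemma boundary_values:
  assumes n: "n \<ge> 1" and a: "Re a > 0" and \<beta>: "0 < \<beta>" "\<beta> \<le> 2 * Re a"
    and p: "p \<in> H_class \<beta> a n"
    and z1: "z\<^sub>1 \<in> ball 0 1" "Re (p z\<^sub>1) \<le> 0"
  obtains z\<^sub>0 where "z\<^sub>0 \<in> ball 0 1" "Re (p z\<^sub>0) = 0" "Im (z\<^sub>0 * deriv p z\<^sub>0) = 0"
    "Re (z\<^sub>0 * deriv p z\<^sub>0) \<le> - (1 / 2) * (real n + (2 * Re a - \<beta>) / (2 * Re a + \<beta>))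
      * ((cmod (a - p z\<^sub>0))\<^sup>2 / Re a)"
    "Re (z\<^sub>0 * deriv p z\<^sub>0) + Re (z\<^sub>0\<^sup>2 * deriv (deriv p) z\<^sub>0) \<le> 0"
proof -
  have hol: "p holomorphic_on ball 0 1"
    using p by (auto simp: H_class_def intro: analytic_imp_holomorphic)
  then obtain z\<^sub>0 where z0: "z\<^sub>0 \<in> ball 0 1" "Re (p z\<^sub>0) \<le> 0"
    and pos: "\<And>z. cmod z < cmod z\<^sub>0 \<Longrightarrow> Re (p z) > 0"
    using first_nonpos_Re z1 holomorphic_on_imp_continuous_on by metis
  obtain h where h: "h holomorphic_on ball 0 1" "h 0 = of_real \<beta>"
    and ph: "\<And>z. z \<in> ball 0 1 \<Longrightarrow> p z = a + z ^ n * h z"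
    using H_class_factor [OF p] by blast
  have "p 0 = a"
    using ph [of 0] n by (simp add: power_0_left)
  then have nz: "z\<^sub>0 \<noteq> 0"
    using z0 a by auto
  \<comment> \<open>The rescaled function \<open>q\<close> is holomorphic on the disc of radius
    \<open>R > 1\<close>, so 1 is an interior point and both derivatives exist there.\<close>
  define R where "R = 1 / cmod z\<^sub>0"
  have R: "R > 1"
    using z0 nz by (simp add: R_def)
  have in_ball: "z\<^sub>0 * z \<in> ball 0 1" if "z \<in> ball 0 R" for z
    using that nz by (simp add: R_def norm_mult field_simps)
  define q where "q = (\<lambda>z. p (z\<^sub>0 * z))"
  have der: "(p has_field_derivative deriv p w) (at w)"
    and der2: "(deriv p has_field_derivative deriv (deriv p) w) (at w)" if "w \<in> ball 0 1" for w
    using that by (auto intro!: holomorphic_derivI [OF hol]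
        holomorphic_derivI [OF holomorphic_deriv [OF hol open_ball]])
  have qd: "(q has_field_derivative z\<^sub>0 * deriv p (z\<^sub>0 * z)) (at z)" if "z \<in> ball 0 R" for z
    unfolding q_def
    by (rule DERIV_chain2 [where g = "\<lambda>z. z\<^sub>0 * z", OF der [OF in_ball [OF that]], THEN DERIV_cong])
       (auto intro!: derivative_eq_intros)
  have q': "deriv q z = z\<^sub>0 * deriv p (z\<^sub>0 * z)" if "z \<in> ball 0 R" for z
    by (rule DERIV_imp_deriv [OF qd [OF that]])
  have one: "1 \<in> ball (0::complex) R"
    using R by simp
  have "((\<lambda>z. z\<^sub>0 * deriv p (z\<^sub>0 * z)) has_field_derivative z\<^sub>0\<^sup>2 * deriv (deriv p) (z\<^sub>0 * 1)) (at 1)"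
    by (rule DERIV_cmult [OF DERIV_chain2 [where g = "\<lambda>z. z\<^sub>0 * z", OF der2 [OF in_ball [OF one]]], THEN DERIV_cong])
       (auto intro!: derivative_eq_intros simp: power2_eq_square)
  then have "(deriv q has_field_derivative z\<^sub>0\<^sup>2 * deriv (deriv p) (z\<^sub>0 * 1)) (at 1)"
    using one by (rule has_field_derivative_transform_within_open [OF _ open_ball]) (simp add: q')
  then have q'': "deriv (deriv q) 1 = z\<^sub>0\<^sup>2 * deriv (deriv p) z\<^sub>0"
    using DERIV_imp_deriv by fastforce
  have q'1: "deriv q 1 = z\<^sub>0 * deriv p z\<^sub>0" and q1: "q 1 = p z\<^sub>0"
    using q' [OF one] by (auto simp: q_def)
  have hol_q: "q holomorphic_on ball 0 R"
    using qd unfolding holomorphic_on_open [OF open_ball] by blast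
  have q_pos: "Re (q z) > 0" if "z \<in> ball 0 1" for z
    using that nz by (auto simp: q_def norm_mult intro!: pos)
  have q_nonneg: "Re (q z) \<ge> 0" if "cmod z = 1" for z
  proof -
    have "continuous_on (closure (ball 0 1)) (\<lambda>z. Re (q z))"
      using R by (intro continuous_intros holomorphic_on_imp_continuous_on
          holomorphic_on_subset [OF hol_q]) auto
    then show ?thesis
      by (rule continuous_ge_on_closure) (use that q_pos in \<open>auto intro: less_imp_le\<close>)
  qed
  \<comment> \<open>Continuity from inside the disc gives \<open>\<ge> 0\<close>, the choice of
    \<open>z\<^sub>0\<close> gives \<open>\<le> 0\<close>.\<close>
  have Re0: "Re (q 1) = 0"
    using q_nonneg [of 1] z0 q1 by simp
  \<comment> \<open>The coefficient of \<open>z ^ n\<close> in \<open>q\<close> is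
    \<open>z\<^sub>0 ^ n * \<beta>\<close>, so \<open>|z\<^sub>0| < 1\<close> and
    \<open>\<beta> \<le> 2 * Re a\<close> give \<open>x < 1\<close>. The argument
    \<open>z\<^sub>0 * 0\<close> is kept to match the function passed to
    \<open>norm_Cayley_le\<close>.\<close>
  define x where "x = cmod (z\<^sub>0 ^ n * h (z\<^sub>0 * 0)) / (2 * Re a)"
  have x_eq: "x = cmod z\<^sub>0 ^ n * (\<beta> / (2 * Re a))"
    using \<beta> by (simp add: x_def h norm_mult norm_power)
  have zn: "cmod z\<^sub>0 ^ n < 1"
    using z0 n by (simp add: power_less_one_iff)
  have x: "0 \<le> x" "x \<le> \<beta> / (2 * Re a)" "x < 1"
  proof -
    show "0 \<le> x" "x \<le> \<beta> / (2 * Re a)"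
      unfolding x_eq using a \<beta> zn by (auto intro: mult_left_le_one_le simp del: times_divide_eq_right)
    have "x \<le> cmod z\<^sub>0 ^ n"
      unfolding x_eq using a \<beta> by (intro mult_right_le_one_le) auto
    then show "x < 1"
      using zn by simp
  qed
  have "Re (deriv q 1) \<le> - (1 / 2) * (real n + (1 - x) / (1 + x)) * ((cmod (a - q 1))\<^sup>2 / Re a)"
  proof (rule boundary_deriv_bound [where q = q, OF a _ Re0 x(1)])
    show "(q has_field_derivative deriv q 1) (at 1)"
      using qd [OF one] q' [OF one] by simp
    fix t :: real assume t: "0 < t" "t < 1"
    have "cmod (a - q (of_real t)) \<le> cmod (of_real t) ^ n
        * ((cmod (of_real t) + x) / (1 + x * cmod (of_real t))) * cmod (cnj a + q (of_real t))"
    proof (rule norm_Cayley_le [where h = "\<lambda>z. z\<^sub>0 ^ n * h (z\<^sub>0 * z)", OF a _ _ q_pos x_def x(3) n])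
      show "(\<lambda>z. z\<^sub>0 ^ n * h (z\<^sub>0 * z)) holomorphic_on ball 0 1"
        using in_ball R
        by (intro holomorphic_intros holomorphic_on_compose_gen [OF _ h(1), unfolded o_def]) auto
      show "q z = a + z ^ n * (z\<^sub>0 ^ n * h (z\<^sub>0 * z))" if "z \<in> ball 0 1" for z
        using ph [OF in_ball [of z]] that R by (simp add: q_def power_mult_distrib mult_ac)
    qed (use t in auto)
    then show "cmod (a - q (of_real t))
        \<le> t ^ n * ((t + x) / (1 + x * t)) * cmod (cnj a + q (of_real t))"
      using t by simp
  qed
  \<comment> \<open>The map \<open>x \<mapsto> (1 - x) / (1 + x)\<close> is decreasing, and its
    value at \<open>\<beta> / (2 * Re a)\<close>, an upper bound for \<open>x\<close>, is the
    fraction required.\<close>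
  also have "\<dots> \<le> - (1 / 2) * (real n + (2 * Re a - \<beta>) / (2 * Re a + \<beta>))
      * ((cmod (a - q 1))\<^sup>2 / Re a)"
  proof -
    have "(2 * Re a - \<beta>) / (2 * Re a + \<beta>) \<le> (1 - x) / (1 + x)"
      using a \<beta> x by (simp add: field_simps)
    then show ?thesis
      using a by (intro mult_right_mono mult_left_mono_neg add_left_mono) auto
  qed
  finally show ?thesis
    using boundary_min_angular_derivs [OF hol_q R q_nonneg Re0] Re0 z0
    by (intro that [of z\<^sub>0]) (auto simp: q'1 q'' q1)
qed

section \<open>Contradiction with admissibility\<close>

text \<open>Common core of both assertions; the second takes the right half-plane for
  \<open>\<Omega>\<close>. At \<open>z\<^sub>0\<close> the triple has exactly the form that
  \<open>\<psi>\<close> must send outside \<open>\<Omega>\<close>.\<close>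

lemma admissible_imp_Re_pos:
  assumes n: "n \<ge> 1" and a: "Re a > 0" and \<beta>: "0 < \<beta>" "\<beta> \<le> 2 * Re a"
    and p: "p \<in> H_class \<beta> a n"
    and \<psi>: "\<psi> \<in> Psi_class n \<beta> \<Omega> a D"
    and adm: "\<And>z. z \<in> ball 0 1 \<Longrightarrow> (p z, z * deriv p z, z\<^sup>2 * deriv (deriv p) z) \<in> D \<and>
      \<psi> (p z, z * deriv p z, z\<^sup>2 * deriv (deriv p) z) \<in> \<Omega>"
    and z: "z \<in> ball 0 1"
  shows "Re (p z) > 0"
proof (rule ccontr)
  assume "\<not> Re (p z) > 0"
  then obtain z\<^sub>0 where z0: "z\<^sub>0 \<in> ball 0 1" "Re (p z\<^sub>0) = 0" "Im (z\<^sub>0 * deriv p z\<^sub>0) = 0"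
    "Re (z\<^sub>0 * deriv p z\<^sub>0) \<le> - (1 / 2) * (real n + (2 * Re a - \<beta>) / (2 * Re a + \<beta>))
      * ((cmod (a - p z\<^sub>0))\<^sup>2 / Re a)"
    "Re (z\<^sub>0 * deriv p z\<^sub>0) + Re (z\<^sub>0\<^sup>2 * deriv (deriv p) z\<^sub>0) \<le> 0"
    using boundary_values [OF n a \<beta> p z] by (metis not_less)
  \<comment> \<open>\<open>Re w\<close> and \<open>Im w\<close> serve as \<mu> and \<nu> of the
    admissibility condition.\<close>
  define \<rho> \<sigma> w where "\<rho> = Im (p z\<^sub>0)" and "\<sigma> = Re (z\<^sub>0 * deriv p z\<^sub>0)"
    and "w = z\<^sub>0\<^sup>2 * deriv (deriv p) z\<^sub>0"
  have eqs: "p z\<^sub>0 = \<i> * of_real \<rho>" "z\<^sub>0 * deriv p z\<^sub>0 = of_real \<sigma>"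
    "z\<^sub>0\<^sup>2 * deriv (deriv p) z\<^sub>0 = of_real (Re w) + \<i> * of_real (Im w)"
    using z0 by (auto simp: complex_eq_iff \<rho>_def \<sigma>_def w_def)
  have "\<sigma> + Re w \<le> 0"
    using z0(5) by (simp add: \<sigma>_def w_def)
  moreover have "\<sigma> \<le> - (1 / 2) * (real n + (2 * Re a - \<beta>) / (2 * Re a + \<beta>))
      * ((cmod (a - \<i> * of_real \<rho>))\<^sup>2 / Re a)"
    using z0(4) unfolding \<sigma>_def [symmetric] eqs(1) .
  ultimately show False
    using \<psi> adm [OF z0(1)] unfolding Psi_class_def mem_Collect_eq eqs by blast
qed

theorem theorem3p4:
  fixes n :: nat and a :: complex and \<beta> :: real and p :: "complex \<Rightarrow> complex"
  assumes "n \<ge> 1" and "Re a > 0" and "0 < \<beta>" and "\<beta> \<le> 2 * Re a"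
    and "p \<in> H_class \<beta> a n"
  shows "(\<forall>\<Omega> D \<psi>.
            is_domain \<Omega> \<longrightarrow>
            \<psi> \<in> Psi_class n \<beta> \<Omega> a D \<longrightarrow>
            (\<forall>z\<in>ball 0 1. (p z, z * deriv p z, z\<^sup>2 * deriv (deriv p) z) \<in> D \<and>
               \<psi> (p z, z * deriv p z, z\<^sup>2 * deriv (deriv p) z) \<in> \<Omega>) \<longrightarrow>
            (\<forall>z\<in>ball 0 1. Re (p z) > 0))
       \<and> (\<forall>D \<psi>.
            \<psi> \<in> Psi_class_rhp n \<beta> a D \<longrightarrow>
            (\<forall>z\<in>ball 0 1. (p z, z * deriv p z, z\<^sup>2 * deriv (deriv p) z) \<in> D \<and>
               Re (\<psi> (p z, z * deriv p z, z\<^sup>2 * deriv (deriv p) z)) > 0) \<longrightarrow>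
            (\<forall>z\<in>ball 0 1. Re (p z) > 0))"
proof (intro conjI allI impI ballI)
  fix \<Omega> D \<psi> z
  assume "\<psi> \<in> Psi_class n \<beta> \<Omega> a D"
    and "\<forall>z\<in>ball 0 1. (p z, z * deriv p z, z\<^sup>2 * deriv (deriv p) z) \<in> D \<and>
      \<psi> (p z, z * deriv p z, z\<^sup>2 * deriv (deriv p) z) \<in> \<Omega>"
    and "z \<in> ball (0::complex) 1"
  then show "Re (p z) > 0"
    using admissible_imp_Re_pos [OF assms] by blast
next
  fix D \<psi> z
  assume "\<psi> \<in> Psi_class_rhp n \<beta> a D"
    and "\<forall>z\<in>ball 0 1. (p z, z * deriv p z, z\<^sup>2 * deriv (deriv p) z) \<in> D \<and>
      Re (\<psi> (p z, z * deriv p z, z\<^sup>2 * deriv (deriv p) z)) > 0"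
    and "z \<in> ball (0::complex) 1"
  then show "Re (p z) > 0"
    using admissible_imp_Re_pos [OF assms, of \<psi> "{w. Re w > 0}" D z]
    unfolding Psi_class_rhp_def by blast
qed

end
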